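(* Let $\alpha>0$, $\gamma<0$, $\theta=(\alpha,-(\alpha+\gamma)/4,\gamma)$, and let $\mathcal{R}_\theta(1)$ be the moduli space of $\theta$-semistable representations of $\mathbf{Q}$ of dimension vector $(1,4,1)$. If $\gamma<-\alpha$, the points of $\mathcal{R}_\theta(1)$ are exactly the (isomorphism classes of) representations that are globally surjective and locally injective. If $\gamma>-\alpha$, the points of $\mathcal{R}_\theta(1)$ are exactly the representations that are globally injective and locally surjective.
   Context: The quiver $\mathbf{Q}$ has vertices $-1,0,1$, arrows $\eta_0,\dots,\eta_3:-1\to0$, $\phi_0,\dots,\phi_3:0\to1$ and relations $\phi_i\eta_j+\phi_j\eta_i=0$; a representation consists of vector spaces $V_{-1},V_0,V_1$ and linear maps $f_i:V_{-1}\to V_0$, $g_i:V_0\to V_1$ with $g_if_j+g_jf_i=0$. $R$ is globally injective (resp. surjective) if $\sum\lambda_if_i$ is injective (resp. $\sum\lambda_ig_i$ surjective) for all $\lambda\in\mathbb{C}^4\setminus\{0\}$; locally injective (resp. surjective) if this holds for all $[\lambda]\in\mathbb{P}^3$ outside a closed subset of codimension at least 2. $R$ is $\theta$-semistable (resp. stable) if $\theta\cdot\dim R=0$ and $\theta\cdot\dim S\le0$ for all subrepresentations $S$ (resp. $<0$ for all nonzero proper $S$); $\mathcal{R}_\theta(1)$ is King's GIT moduli space. *)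

theory Defs
  imports "HOL-Analysis.Analysis"
begin

text \<open>Representations of the quiver Q of dimension vector (1,4,1), realised on the
standard spaces V_{-1} = C^1, V_0 = C^4, V_1 = C^1.  Arrows are indexed by the
type 4 (elements 0,1,2,3).  f i : V_{-1} -> V_0 is a 4x1 matrix,
g i : V_0 -> V_1 a 1x4 matrix.\<close>

type_synonym rep141 = "(4 \<Rightarrow> complex^1^4) \<times> (4 \<Rightarrow> complex^4^1)"

definition is_rep :: "rep141 \<Rightarrow> bool" where
  "is_rep R \<longleftrightarrow> (\<forall>i j. snd R i ** fst R j + snd R j ** fst R i = 0)"

text \<open>The linear combination sum_i lambda_i A_i of matrices.\<close>
definition lincomb :: "complex^4 \<Rightarrow> (4 \<Rightarrow> complex^'m^'n) \<Rightarrow> complex^'m^'n" where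
  "lincomb l A = (\<chi> r c. \<Sum>i\<in>UNIV. l $ i * A i $ r $ c)"

definition globally_injective :: "rep141 \<Rightarrow> bool" where
  "globally_injective R \<longleftrightarrow> (\<forall>l. l \<noteq> 0 \<longrightarrow> inj ((*v) (lincomb l (fst R))))"

definition globally_surjective :: "rep141 \<Rightarrow> bool" where
  "globally_surjective R \<longleftrightarrow> (\<forall>l. l \<noteq> 0 \<longrightarrow> surj ((*v) (lincomb l (snd R))))"

subsection \<open>Projective 3-space and its Zariski topology\<close>

text \<open>A point [lambda] of P^3 is the set of nonzero multiples of lambda.\<close>
definition ppt :: "complex^4 \<Rightarrow> (complex^4) set" where
  "ppt l = {c *s l | c. c \<noteq> 0}"

definition P3 :: "(complex^4) set set" where
  "P3 = ppt ` (UNIV - {0})"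

text \<open>Homogeneous polynomial functions of degree d in four variables.\<close>
definition hom_poly :: "nat \<Rightarrow> (complex^4 \<Rightarrow> complex) \<Rightarrow> bool" where
  "hom_poly d p \<longleftrightarrow> (\<exists>c :: (4 \<Rightarrow> nat) \<Rightarrow> complex.
      p = (\<lambda>x. \<Sum>e\<in>{e. sum e UNIV = d}. c e * (\<Prod>i\<in>UNIV. (x $ i) ^ e i)))"

text \<open>Zariski-closed subsets of P^3: common zero loci of families of homogeneous polynomials.\<close>
definition zariski_closed :: "(complex^4) set set \<Rightarrow> bool" where
  "zariski_closed Z \<longleftrightarrow> (\<exists>F. (\<forall>p\<in>F. \<exists>d. hom_poly d p) \<and>
      Z = {ppt l | l. l \<noteq> 0 \<and> (\<forall>p\<in>F. p l = 0)})"

definition zariski_irreducible :: "(complex^4) set set \<Rightarrow> bool" where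
  "zariski_irreducible Y \<longleftrightarrow> zariski_closed Y \<and> Y \<noteq> {} \<and>
     (\<forall>Y1 Y2. zariski_closed Y1 \<and> zariski_closed Y2 \<and> Y = Y1 \<union> Y2 \<longrightarrow> Y = Y1 \<or> Y = Y2)"

text \<open>Topological codimension at least 2: every irreducible closed subset of Z is the
bottom of a strict chain of length 2 of irreducible closed subsets of P^3.\<close>
definition codim_ge2 :: "(complex^4) set set \<Rightarrow> bool" where
  "codim_ge2 Z \<longleftrightarrow> (\<forall>Y. zariski_irreducible Y \<and> Y \<subseteq> Z \<longrightarrow>
      (\<exists>Y1 Y2. zariski_irreducible Y1 \<and> zariski_irreducible Y2 \<and> Y \<subset> Y1 \<and> Y1 \<subset> Y2))"

definition locally_injective :: "rep141 \<Rightarrow> bool" where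
  "locally_injective R \<longleftrightarrow> (\<exists>Z. zariski_closed Z \<and> codim_ge2 Z \<and>
      (\<forall>l. l \<noteq> 0 \<and> ppt l \<notin> Z \<longrightarrow> inj ((*v) (lincomb l (fst R)))))"

definition locally_surjective :: "rep141 \<Rightarrow> bool" where
  "locally_surjective R \<longleftrightarrow> (\<exists>Z. zariski_closed Z \<and> codim_ge2 Z \<and>
      (\<forall>l. l \<noteq> 0 \<and> ppt l \<notin> Z \<longrightarrow> surj ((*v) (lincomb l (snd R)))))"

subsection \<open>Subrepresentations and King stability\<close>

definition is_subrep :: "rep141 \<Rightarrow> (complex^1) set \<Rightarrow> (complex^4) set \<Rightarrow> (complex^1) set \<Rightarrow> bool" where
  "is_subrep R Wm W0 W1 \<longleftrightarrow> vec.subspace Wm \<and> vec.subspace W0 \<and> vec.subspace W1 \<and>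
     (\<forall>i x. x \<in> Wm \<longrightarrow> fst R i *v x \<in> W0) \<and>
     (\<forall>i y. y \<in> W0 \<longrightarrow> snd R i *v y \<in> W1)"

definition theta_dot :: "real \<times> real \<times> real \<Rightarrow> nat \<times> nat \<times> nat \<Rightarrow> real" where
  "theta_dot th d = fst th * real (fst d) + fst (snd th) * real (fst (snd d))
                    + snd (snd th) * real (snd (snd d))"

definition sdim :: "(complex^1) set \<Rightarrow> (complex^4) set \<Rightarrow> (complex^1) set \<Rightarrow> nat \<times> nat \<times> nat" where
  "sdim Wm W0 W1 = (vec.dim Wm, vec.dim W0, vec.dim W1)"

definition semistable :: "real \<times> real \<times> real \<Rightarrow> rep141 \<Rightarrow> bool" where
  "semistable th R \<longleftrightarrow> theta_dot th (1, 4, 1) = 0 \<and>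
     (\<forall>Wm W0 W1. is_subrep R Wm W0 W1 \<longrightarrow> theta_dot th (sdim Wm W0 W1) \<le> 0)"

definition stable :: "real \<times> real \<times> real \<Rightarrow> rep141 \<Rightarrow> bool" where
  "stable th R \<longleftrightarrow> theta_dot th (1, 4, 1) = 0 \<and>
     (\<forall>Wm W0 W1. is_subrep R Wm W0 W1 \<and> (Wm, W0, W1) \<noteq> ({0}, {0}, {0})
        \<and> (Wm, W0, W1) \<noteq> (UNIV, UNIV, UNIV) \<longrightarrow> theta_dot th (sdim Wm W0 W1) < 0)"

end

theory Submission
  imports Defs "HOL-Computational_Algebra.Polynomial"
begin

(* Write F for the matrix whose columns are the vectors f_j(1) and G for the matrix whose rows
   are the forms g_i. The relations say that the matrix M = G F of composites g_i f_j is skew.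
   Since alpha + 4 beta + gamma = 0, theta vanishes on no dimension vector strictly between 0 and
   (1,4,1), so semistability equals stability, and the sign of beta decides which
   subrepresentations destabilise: those with zero top space (beta > 0), resp. those with full
   source but not everything (beta < 0). There are none iff G (resp. F) is injective and M is
   nonzero. Global surjectivity (resp. injectivity) is the invertibility of G (resp. F), and
   then M is nonzero iff the representation is locally injective (resp. surjective): outside
   the kernel locus of M both F l and l G are nonzero, and for a nonzero skew M this locus lies
   properly inside a hyperplane, hence has codimension 2. *)

section \<open>Linear algebra\<close>

lemma scalar_product_add_smult:
  fixes a x y :: "'a::comm_semiring_1^'n"
  shows "scalar_product a (x + c *s y) = scalar_product a x + c * scalar_product a y"
proof -
  have "scalar_product a (x + c *s y) = (\<Sum>i\<in>UNIV. a $ i * x $ i + c * (a $ i * y $ i))"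
    unfolding scalar_product_def by (intro sum.cong) (simp_all add: algebra_simps)
  then show ?thesis
    by (simp add: scalar_product_def sum.distrib sum_distrib_left)
qed

lemma scalar_product_axis: "scalar_product w (axis i 1) = w $ i"
  by (simp add: scalar_product_def axis_def if_distrib cong: if_cong)

lemma matrix_vector_mult_component: "(A *v x) $ i = scalar_product (A $ i) x"
  by (simp add: matrix_vector_mult_def scalar_product_def)

lemma matrix_vector_mult_axis: "A *v axis k 1 = column k A"
  by (simp add: vec_eq_iff matrix_vector_mult_component scalar_product_axis column_def)

lemma column_matrix_mult: "column j (A ** B) = A *v column j B"
  by (simp add: vec_eq_iff column_def matrix_matrix_mult_def matrix_vector_mult_def)

lemma matrix_vector_mult_eq_sum_columns:
  fixes A :: "'a::comm_semiring_1^'n^'m"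
  shows "A *v x = (\<Sum>j\<in>UNIV. x $ j *s column j A)"
  by (simp add: vec_eq_iff matrix_vector_mult_def column_def sum_component mult.commute)

lemma matrix_eq_0_iff_columns: "A = 0 \<longleftrightarrow> (\<forall>j. column j A = 0)"
  by (auto simp: vec_eq_iff column_def)

lemma trivial_kernel_iff_surj:
  fixes A :: "'a::field^'n^'n"
  shows "(\<forall>x. A *v x = 0 \<longrightarrow> x = 0) \<longleftrightarrow> surj ((*v) A)"
  by (metis matrix_left_invertible_ker matrix_left_right_inverse matrix_right_invertible_surjective)

lemma trivial_left_kernel_iff_trivial_kernel:
  fixes A :: "'a::field^'n^'n"
  shows "(\<forall>x. x v* A = 0 \<longrightarrow> x = 0) \<longleftrightarrow> (\<forall>x. A *v x = 0 \<longrightarrow> x = 0)"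
proof -
  have "(\<forall>x. x v* A = 0 \<longrightarrow> x = 0) \<longleftrightarrow> (\<exists>B. B ** transpose A = mat 1)"
    by (simp add: matrix_left_invertible_ker)
  also have "\<dots> \<longleftrightarrow> (\<exists>B. B ** A = mat 1)"
    by (metis left_invertible_transpose matrix_left_right_inverse)
  also have "\<dots> \<longleftrightarrow> (\<forall>x. A *v x = 0 \<longrightarrow> x = 0)"
    by (rule matrix_left_invertible_ker)
  finally show ?thesis .
qed

lemma inj_scale_column_iff: "inj (\<lambda>x::'a::field^1. x $ 1 *s u) \<longleftrightarrow> u \<noteq> 0"
proof
  assume inj: "inj (\<lambda>x::'a^1. x $ 1 *s u)"
  show "u \<noteq> 0"
  proof
    assume "u = 0"
    then have "(1::'a^1) $ 1 *s u = (0::'a^1) $ 1 *s u"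
      by simp
    with inj have "(1::'a^1) = 0"
      by (rule injD)
    then show False
      by (simp add: vec_eq_iff)
  qed
next
  assume "u \<noteq> 0"
  show "inj (\<lambda>x::'a^1. x $ 1 *s u)"
  proof (rule injI)
    fix x y :: "'a^1"
    assume "x $ 1 *s u = y $ 1 *s u"
    then have "(x $ 1 - y $ 1) *s u = 0"
      by (simp add: vector_ssub_ldistrib algebra_simps)
    with \<open>u \<noteq> 0\<close> have "x $ 1 = y $ 1"
      by simp
    then show "x = y"
      by (simp add: vec_eq_iff)
  qed
qed

lemma surj_scalar_product_iff: "surj (\<lambda>v. \<chi> _::1. scalar_product w v) \<longleftrightarrow> (w :: 'a::field^'n) \<noteq> 0"
proof
  assume "surj (\<lambda>v. \<chi> _::1. scalar_product w v)"
  then obtain v where "1 = (\<chi> _::1. scalar_product w v)"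
    by (rule surjE)
  then have "scalar_product w v \<noteq> 0"
    by (metis one_index vec_lambda_beta zero_neq_one)
  then show "w \<noteq> 0"
    by (auto simp: scalar_product_def)
next
  assume "w \<noteq> 0"
  then obtain k where "w $ k \<noteq> 0"
    by (metis vec_eq_iff zero_index)
  show "surj (\<lambda>v. \<chi> _::1. scalar_product w v)"
  proof (rule surjI)
    fix y :: "'a^1"
    have "scalar_product w 0 = 0"
      by (simp add: scalar_product_def)
    then have "scalar_product w ((y $ 1 / w $ k) *s axis k 1) = y $ 1"
      using scalar_product_add_smult[of w 0] \<open>w $ k \<noteq> 0\<close> by (simp add: scalar_product_axis)
    then show "(\<chi> _. scalar_product w ((y $ 1 / w $ k) *s axis k 1)) = y"
      by (simp add: vec_eq_iff)
  qed
qed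

lemma subspace_of_line_cases:
  assumes "vec.subspace (S :: ('a::field^1) set)"
  shows "S = {0} \<or> S = UNIV"
proof (cases "S = {0}")
  case False
  then obtain x where "x \<in> S" "x \<noteq> 0"
    using vec.subspace_0[OF assms] by blast
  then have "x $ 1 \<noteq> 0"
    by (simp add: vec_eq_iff)
  have "y = (y $ 1 / x $ 1) *s x" for y :: "'a^1"
    using \<open>x $ 1 \<noteq> 0\<close> by (simp add: vec_eq_iff)
  then have "S = UNIV"
    using vec.subspace_scale[OF assms \<open>x \<in> S\<close>] by (metis UNIV_eq_I)
  then show ?thesis ..
qed simp

lemma subspace_dim_eq_0_iff: "vec.subspace S \<Longrightarrow> vec.dim S = 0 \<longleftrightarrow> S = {0}"
  using vec.subspace_0 by auto

lemma subspace_dim_eq_card_iff: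
  fixes S :: "('a::field^'n) set"
  assumes "vec.subspace S"
  shows "vec.dim S = CARD('n) \<longleftrightarrow> S = UNIV"
  using vec.subspace_dim_equal[OF assms vec.subspace_UNIV subset_UNIV] vec_dim_card by auto

section \<open>Closed subsets of projective 3-space\<close>

lemma hom_poly_smult:
  assumes "hom_poly d p"
  shows "p (c *s x) = c ^ d * p x"
proof -
  obtain cf where p: "p = (\<lambda>x. \<Sum>e\<in>{e. sum e UNIV = d}. cf e * (\<Prod>i\<in>UNIV. (x $ i) ^ e i))"
    using assms unfolding hom_poly_def by blast
  have "(\<Prod>i\<in>UNIV. ((c *s x) $ i) ^ e i) = c ^ d * (\<Prod>i\<in>UNIV. (x $ i) ^ e i)"
    if "sum e UNIV = d" for e :: "4 \<Rightarrow> nat"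
    using that by (simp add: power_mult_distrib prod.distrib power_sum[symmetric])
  then show ?thesis
    unfolding p by (simp add: sum_distrib_left mult.left_commute)
qed

lemma hom_poly_on_line:
  assumes "hom_poly d p"
  obtains P where "\<And>t. p (a + t *s b) = poly P t"
proof -
  obtain cf where p: "p = (\<lambda>x. \<Sum>e\<in>{e. sum e UNIV = d}. cf e * (\<Prod>i\<in>UNIV. (x $ i) ^ e i))"
    using assms unfolding hom_poly_def by blast
  let ?P = "\<Sum>e\<in>{e. sum e UNIV = d}. [:cf e:] * (\<Prod>i\<in>UNIV. [:a $ i, b $ i:] ^ e i)"
  have "p (a + t *s b) = poly ?P t" for t
    unfolding p poly_sum poly_prod by (simp add: poly_prod algebra_simps)
  then show ?thesis by (rule that)
qed

lemma hom_poly_scalar_product: "hom_poly 1 (scalar_product a)"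
proof -
  define exp_unit :: "4 \<Rightarrow> 4 \<Rightarrow> nat" where "exp_unit k = (\<lambda>i. if i = k then 1 else 0)" for k
  have "inj exp_unit"
    by (rule injI) (metis exp_unit_def zero_neq_one)
  have exps: "{e :: 4 \<Rightarrow> nat. sum e UNIV = 1} = range exp_unit"
  proof (intro equalityI subsetI)
    fix e :: "4 \<Rightarrow> nat" assume "e \<in> {e. sum e UNIV = 1}"
    then have "sum e UNIV = 1" by simp
    then obtain k where "e k = 1" "\<forall>i\<in>UNIV - {k}. e i = 0"
      using sum_eq_1_iff[of UNIV e] by auto
    then have "e = exp_unit k" by (auto simp: exp_unit_def)
    then show "e \<in> range exp_unit" by blast
  qed (auto simp: exp_unit_def)
  have monomial: "(\<Prod>i\<in>UNIV. (x $ i) ^ exp_unit k i) = x $ k" for x :: "complex^4" and k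
    by (simp add: exp_unit_def if_distrib cong: if_cong)
  have "scalar_product a =
      (\<lambda>x. \<Sum>e\<in>{e. sum e UNIV = 1}. a $ inv exp_unit e * (\<Prod>i\<in>UNIV. (x $ i) ^ e i))"
    unfolding exps fun_eq_iff
    by (simp add: sum.reindex[OF \<open>inj exp_unit\<close>] inv_f_f[OF \<open>inj exp_unit\<close>] monomial
        scalar_product_def)
  then show ?thesis
    unfolding hom_poly_def by (intro exI)
qed

definition zero_locus :: "(complex^4 \<Rightarrow> complex) set \<Rightarrow> (complex^4) set set" where
  "zero_locus F = {ppt l | l. l \<noteq> 0 \<and> (\<forall>p\<in>F. p l = 0)}"

definition hyperplane :: "complex^4 \<Rightarrow> (complex^4) set set" where
  "hyperplane a = zero_locus {scalar_product a}"

definition kernel_locus :: "complex^4^'m \<Rightarrow> (complex^4) set set" where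
  "kernel_locus M = zero_locus (range (\<lambda>k. scalar_product (M $ k)))"

lemma zariski_closed_iff_zero_locus:
  "zariski_closed Z \<longleftrightarrow> (\<exists>F. (\<forall>p\<in>F. \<exists>d. hom_poly d p) \<and> Z = zero_locus F)"
  unfolding zariski_closed_def zero_locus_def ..

lemma zero_locus_antimono: "F \<subseteq> G \<Longrightarrow> zero_locus G \<subseteq> zero_locus F"
  unfolding zero_locus_def by blast

lemma P3_eq_zero_locus_empty: "P3 = zero_locus {}"
  unfolding P3_def zero_locus_def by blast

lemma ppt_in_zero_locus_iff:
  assumes "l \<noteq> 0" and "\<forall>p\<in>F. \<exists>d. hom_poly d p"
  shows "ppt l \<in> zero_locus F \<longleftrightarrow> (\<forall>p\<in>F. p l = 0)"
proof
  assume "ppt l \<in> zero_locus F"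
  then obtain l' where l': "ppt l = ppt l'" "\<forall>p\<in>F. p l' = 0"
    unfolding zero_locus_def by blast
  have "l \<in> ppt l"
    unfolding ppt_def by (rule CollectI, rule exI[of _ 1]) simp
  then obtain c where "l = c *s l'"
    using l'(1) unfolding ppt_def by blast
  then show "\<forall>p\<in>F. p l = 0"
    using l'(2) assms(2) hom_poly_smult by fastforce
next
  assume "\<forall>p\<in>F. p l = 0"
  with assms(1) show "ppt l \<in> zero_locus F"
    unfolding zero_locus_def by blast
qed

lemma ppt_in_hyperplane_iff:
  assumes "l \<noteq> 0"
  shows "ppt l \<in> hyperplane a \<longleftrightarrow> scalar_product a l = 0"
proof -
  have "\<forall>p\<in>{scalar_product a}. \<exists>d. hom_poly d p"
    using hom_poly_scalar_product by blast
  from ppt_in_zero_locus_iff[OF assms this] show ?thesis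
    unfolding hyperplane_def by simp
qed

lemma ppt_in_kernel_locus_iff:
  assumes "l \<noteq> 0"
  shows "ppt l \<in> kernel_locus M \<longleftrightarrow> M *v l = 0"
proof -
  have "\<forall>p\<in>range (\<lambda>k. scalar_product (M $ k)). \<exists>d. hom_poly d p"
    using hom_poly_scalar_product by blast
  from ppt_in_zero_locus_iff[OF assms this] show ?thesis
    unfolding kernel_locus_def by (simp add: vec_eq_iff matrix_vector_mult_def scalar_product_def)
qed

lemma zariski_closed_kernel_locus: "zariski_closed (kernel_locus M)"
proof -
  have "\<forall>p\<in>range (\<lambda>k. scalar_product (M $ k)). \<exists>d. hom_poly d p"
    using hom_poly_scalar_product by blast
  then show ?thesis
    unfolding zariski_closed_iff_zero_locus kernel_locus_def by blast
qed

lemma kernel_locus_subset_hyperplane: "kernel_locus M \<subseteq> hyperplane (M $ i)"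
  unfolding kernel_locus_def hyperplane_def by (rule zero_locus_antimono) blast

lemma hom_polys_nonvanishing_on_line:
  assumes "hom_poly d1 p1" "hom_poly d2 p2" "p1 a \<noteq> 0" "p2 b \<noteq> 0" "a \<noteq> 0"
  obtains t where "a + t *s (b - a) \<noteq> 0" "p1 (a + t *s (b - a)) \<noteq> 0" "p2 (a + t *s (b - a)) \<noteq> 0"
proof -
  obtain P1 where P1: "\<And>t. p1 (a + t *s (b - a)) = poly P1 t"
    using hom_poly_on_line[OF assms(1)] by blast
  obtain P2 where P2: "\<And>t. p2 (a + t *s (b - a)) = poly P2 t"
    using hom_poly_on_line[OF assms(2)] by blast
  obtain k where k: "a $ k \<noteq> 0"
    using assms(5) by (metis vec_eq_iff zero_index)
  let ?L = "[:a $ k, b $ k - a $ k:]"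
  have "poly P1 0 \<noteq> 0" "poly P2 1 \<noteq> 0" "poly ?L 0 \<noteq> 0"
    using P1[of 0] P2[of 1] assms(3,4) k by simp_all
  then have "P1 \<noteq> 0" "P2 \<noteq> 0" "?L \<noteq> 0"
    by auto
  then have "P1 * P2 * ?L \<noteq> 0"
    by (metis mult_eq_0_iff)
  then obtain t where "poly (P1 * P2 * ?L) t \<noteq> 0"
    using poly_all_0_iff_0 by blast
  then have t: "poly P1 t \<noteq> 0" "poly P2 t \<noteq> 0" "poly ?L t \<noteq> 0"
    by (metis mult_eq_0_iff poly_mult)+
  have "(a + t *s (b - a)) $ k = poly ?L t"
    by (simp add: algebra_simps)
  with t(3) have "a + t *s (b - a) \<noteq> 0"
    by (metis zero_index)
  with t(1,2) show ?thesis
    using that[of t] unfolding P1 P2 by blast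
qed

lemma zariski_irreducible_zero_locus_of_subspace:
  assumes hom: "\<forall>p\<in>F. \<exists>d. hom_poly d p"
    and subspace: "\<And>x y c. \<forall>p\<in>F. p x = 0 \<Longrightarrow> \<forall>p\<in>F. p y = 0 \<Longrightarrow> \<forall>p\<in>F. p (x + c *s y) = 0"
    and "v \<noteq> 0" "\<forall>p\<in>F. p v = 0"
  shows "zariski_irreducible (zero_locus F)"
  unfolding zariski_irreducible_def
proof (intro conjI allI impI)
  show "zariski_closed (zero_locus F)"
    using hom zariski_closed_iff_zero_locus by blast
  show "zero_locus F \<noteq> {}"
    using assms(3,4) unfolding zero_locus_def by blast
next
  fix Y1 Y2 assume Y: "zariski_closed Y1 \<and> zariski_closed Y2 \<and> zero_locus F = Y1 \<union> Y2"
  obtain F1 where F1: "\<forall>p\<in>F1. \<exists>d. hom_poly d p" "Y1 = zero_locus F1"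
    using Y zariski_closed_iff_zero_locus by blast
  obtain F2 where F2: "\<forall>p\<in>F2. \<exists>d. hom_poly d p" "Y2 = zero_locus F2"
    using Y zariski_closed_iff_zero_locus by blast
  show "zero_locus F = Y1 \<or> zero_locus F = Y2"
  proof (rule ccontr)
    assume "\<not> ?thesis"
    with Y obtain y1 y2 where "y1 \<in> zero_locus F - Y1" "y2 \<in> zero_locus F - Y2"
      by blast
    then obtain a b where a: "a \<noteq> 0" "\<forall>p\<in>F. p a = 0" "ppt a \<notin> Y1"
      and b: "b \<noteq> 0" "\<forall>p\<in>F. p b = 0" "ppt b \<notin> Y2"
      unfolding zero_locus_def by blast
    obtain p1 d1 where p1: "p1 \<in> F1" "p1 a \<noteq> 0" "hom_poly d1 p1"
      using a ppt_in_zero_locus_iff[OF a(1) F1(1)] F1 by blast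
    obtain p2 d2 where p2: "p2 \<in> F2" "p2 b \<noteq> 0" "hom_poly d2 p2"
      using b ppt_in_zero_locus_iff[OF b(1) F2(1)] F2 by blast
    obtain t where t: "a + t *s (b - a) \<noteq> 0" "p1 (a + t *s (b - a)) \<noteq> 0" "p2 (a + t *s (b - a)) \<noteq> 0"
      using hom_polys_nonvanishing_on_line[OF p1(3) p2(3) p1(2) p2(2) a(1)] .
    have "b + (-1) *s a = b - a"
      by (simp add: vec_eq_iff)
    moreover have "\<forall>p\<in>F. p (a + t *s (b + (-1) *s a)) = 0"
      by (rule subspace[OF a(2) subspace[OF b(2) a(2)]])
    ultimately have "\<forall>p\<in>F. p (a + t *s (b - a)) = 0"
      by simp
    then have "ppt (a + t *s (b - a)) \<in> zero_locus F"
      using t(1) unfolding zero_locus_def by blast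
    then have "ppt (a + t *s (b - a)) \<in> Y1 \<union> Y2"
      using Y by simp
    moreover have "ppt (a + t *s (b - a)) \<notin> Y1"
      using t(1,2) p1(1) ppt_in_zero_locus_iff[OF t(1) F1(1)] F1(2) by blast
    moreover have "ppt (a + t *s (b - a)) \<notin> Y2"
      using t(1,3) p2(1) ppt_in_zero_locus_iff[OF t(1) F2(1)] F2(2) by blast
    ultimately show False
      by blast
  qed
qed

lemma zariski_irreducible_hyperplane:
  assumes "x \<noteq> 0" "scalar_product a x = 0"
  shows "zariski_irreducible (hyperplane a)"
  unfolding hyperplane_def
proof (rule zariski_irreducible_zero_locus_of_subspace)
  show "\<forall>p\<in>{scalar_product a}. \<exists>d. hom_poly d p"
    using hom_poly_scalar_product by blast
  show "\<forall>p\<in>{scalar_product a}. p (y + c *s z) = 0"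
    if "\<forall>p\<in>{scalar_product a}. p y = 0" "\<forall>p\<in>{scalar_product a}. p z = 0" for y z c
    using that by (simp add: scalar_product_add_smult)
qed (use assms in simp_all)

lemma zariski_irreducible_P3: "zariski_irreducible P3"
  unfolding P3_eq_zero_locus_empty
  by (rule zariski_irreducible_zero_locus_of_subspace[of _ "axis 1 1"]) simp_all

lemma not_codim_ge2_P3: "\<not> codim_ge2 P3"
proof
  assume "codim_ge2 P3"
  then obtain Y1 where "zariski_irreducible Y1" "P3 \<subset> Y1"
    unfolding codim_ge2_def using zariski_irreducible_P3 by blast
  then obtain F where "Y1 = zero_locus F"
    unfolding zariski_irreducible_def zariski_closed_iff_zero_locus by blast
  with \<open>P3 \<subset> Y1\<close> show False
    unfolding P3_eq_zero_locus_empty using zero_locus_antimono[of "{}" F] by blast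
qed

lemma codim_ge2_point_outside:
  assumes "zariski_closed Z" "codim_ge2 Z"
  obtains l where "l \<noteq> 0" "ppt l \<notin> Z"
proof -
  obtain F where "Z = zero_locus F"
    using assms(1) zariski_closed_iff_zero_locus by blast
  then have "Z \<subseteq> P3"
    unfolding P3_eq_zero_locus_empty by (simp add: zero_locus_antimono)
  moreover have "Z \<noteq> P3"
    using assms(2) not_codim_ge2_P3 by blast
  ultimately obtain p where "p \<in> P3" "p \<notin> Z"
    by blast
  moreover from \<open>p \<in> P3\<close> obtain l where "l \<noteq> 0" "p = ppt l"
    unfolding P3_def by blast
  ultimately show ?thesis
    using that by blast
qed

lemma codim_ge2_properly_inside_hyperplane:
  assumes "Z \<subseteq> hyperplane a"
    and "x \<noteq> 0" "scalar_product a x = 0" "ppt x \<notin> Z"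
    and "y \<noteq> 0" "scalar_product a y \<noteq> 0"
  shows "codim_ge2 Z"
  unfolding codim_ge2_def
proof (intro allI impI exI conjI)
  show "zariski_irreducible (hyperplane a)"
    using assms(2,3) by (rule zariski_irreducible_hyperplane)
  show "zariski_irreducible P3"
    by (rule zariski_irreducible_P3)
  fix Y assume "zariski_irreducible Y \<and> Y \<subseteq> Z"
  then have "Y \<subseteq> Z"
    by blast
  moreover have "ppt x \<in> hyperplane a - Z"
    using assms(2,3,4) ppt_in_hyperplane_iff by blast
  ultimately show "Y \<subset> hyperplane a"
    using assms(1) by blast
  have "ppt y \<in> P3 - hyperplane a"
    using assms(5,6) ppt_in_hyperplane_iff unfolding P3_def by blast
  moreover have "hyperplane a \<subseteq> P3"
    unfolding hyperplane_def P3_eq_zero_locus_empty by (simp add: zero_locus_antimono)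
  ultimately show "hyperplane a \<subset> P3"
    by blast
qed

text \<open>If \<open>M\<^sub>j\<^sub>i \<noteq> 0\<close>, the kernel of \<open>M\<close> lies in the hyperplane of row \<open>i\<close>, which
  contains \<open>e\<^sub>i\<close> (as \<open>M\<^sub>i\<^sub>i = 0\<close>) although \<open>M e\<^sub>i \<noteq> 0\<close>, and misses \<open>e\<^sub>j\<close>.\<close>
lemma codim_ge2_kernel_locus_skew:
  fixes M :: "complex^4^4"
  assumes skew: "transpose M = - M" and "M \<noteq> 0"
  shows "codim_ge2 (kernel_locus M)"
proof -
  obtain i j where ji: "M $ j $ i \<noteq> 0"
    using \<open>M \<noteq> 0\<close> by (metis vec_eq_iff zero_index)
  have entry: "M $ k $ k' = - M $ k' $ k" for k k'
    using arg_cong[OF skew, of "\<lambda>A. A $ k' $ k"] by (simp add: transpose_def)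
  show ?thesis
  proof (rule codim_ge2_properly_inside_hyperplane[OF kernel_locus_subset_hyperplane])
    show "scalar_product (M $ i) (axis i 1) = 0"
      using entry[of i i] by (simp add: scalar_product_axis)
    have "(M *v axis i 1) $ j \<noteq> 0"
      using ji by (simp add: matrix_vector_mult_component scalar_product_axis)
    then have "M *v axis i 1 \<noteq> 0"
      by auto
    then show "ppt (axis i 1) \<notin> kernel_locus M"
      by (simp add: ppt_in_kernel_locus_iff axis_eq_0_iff)
    show "scalar_product (M $ i) (axis j 1) \<noteq> 0"
      using ji entry[of i j] by (simp add: scalar_product_axis)
  qed (simp_all add: axis_eq_0_iff)
qed

section \<open>Representations as pairs of matrices\<close>

definition f_matrix :: "rep141 \<Rightarrow> complex^4^4" where
  "f_matrix R = (\<chi> k j. fst R j $ k $ 1)"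

definition g_matrix :: "rep141 \<Rightarrow> complex^4^4" where
  "g_matrix R = (\<chi> i k. snd R i $ 1 $ k)"

lemma fst_mult_eq: "fst R j *v x = x $ 1 *s column j (f_matrix R)"
  by (simp add: vec_eq_iff matrix_vector_mult_def f_matrix_def column_def mult.commute)

lemma snd_mult_eq: "snd R i *v v = (\<chi> _. (g_matrix R *v v) $ i)"
  by (simp add: vec_eq_iff matrix_vector_mult_def g_matrix_def)

lemma lincomb_fst_mult_eq: "lincomb l (fst R) *v x = x $ 1 *s (f_matrix R *v l)"
  by (simp add: vec_eq_iff matrix_vector_mult_def lincomb_def f_matrix_def sum_distrib_left mult_ac)

lemma lincomb_snd_mult_eq: "lincomb l (snd R) *v v = (\<chi> _. scalar_product (l v* g_matrix R) v)"
  by (simp add: vec_eq_iff matrix_vector_mult_def vector_matrix_mult_def lincomb_def g_matrix_def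
      scalar_product_def sum_distrib_right)

lemma composite_matrix_skew:
  assumes "is_rep R"
  shows "transpose (g_matrix R ** f_matrix R) = - (g_matrix R ** f_matrix R)"
proof -
  have "(snd R i ** fst R j + snd R j ** fst R i) $ 1 $ 1 = 0" for i j
    using assms unfolding is_rep_def by simp
  then show ?thesis
    by (simp add: vec_eq_iff transpose_def matrix_matrix_mult_def g_matrix_def f_matrix_def
        eq_neg_iff_add_eq_0 add.commute)
qed

lemma inj_lincomb_fst_iff: "inj ((*v) (lincomb l (fst R))) \<longleftrightarrow> f_matrix R *v l \<noteq> 0"
proof -
  have "(*v) (lincomb l (fst R)) = (\<lambda>x. x $ 1 *s (f_matrix R *v l))"
    by (simp add: fun_eq_iff lincomb_fst_mult_eq)
  then show ?thesis
    by (simp add: inj_scale_column_iff)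
qed

lemma surj_lincomb_snd_iff: "surj ((*v) (lincomb l (snd R))) \<longleftrightarrow> l v* g_matrix R \<noteq> 0"
proof -
  have "(*v) (lincomb l (snd R)) = (\<lambda>v. \<chi> _. scalar_product (l v* g_matrix R) v)"
    by (simp add: fun_eq_iff lincomb_snd_mult_eq)
  then show ?thesis
    by (simp add: surj_scalar_product_iff)
qed

lemma globally_injective_iff: "globally_injective R \<longleftrightarrow> (\<forall>l. f_matrix R *v l = 0 \<longrightarrow> l = 0)"
  unfolding globally_injective_def inj_lincomb_fst_iff by blast

lemma globally_surjective_iff: "globally_surjective R \<longleftrightarrow> (\<forall>v. g_matrix R *v v = 0 \<longrightarrow> v = 0)"
  unfolding globally_surjective_def surj_lincomb_snd_iff
    trivial_left_kernel_iff_trivial_kernel[symmetric]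
  by blast

section \<open>Local injectivity and surjectivity\<close>

lemma locally_injective_and_surjective_if_composite_nonzero:
  assumes "is_rep R" and "g_matrix R ** f_matrix R \<noteq> 0"
  shows "locally_injective R \<and> locally_surjective R"
proof -
  let ?M = "g_matrix R ** f_matrix R"
  let ?Z = "kernel_locus ?M"
  have Z: "zariski_closed ?Z" "codim_ge2 ?Z"
    using zariski_closed_kernel_locus
      codim_ge2_kernel_locus_skew[OF composite_matrix_skew[OF assms(1)] assms(2)]
    by blast+
  have outside: "?M *v l \<noteq> 0" if "l \<noteq> 0 \<and> ppt l \<notin> ?Z" for l
    using that ppt_in_kernel_locus_iff by blast
  have "f_matrix R *v l \<noteq> 0" if "?M *v l \<noteq> 0" for l
    using that by (metis matrix_vector_mul_assoc matrix_vector_mult_0_right)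
  with Z outside have "locally_injective R"
    unfolding locally_injective_def inj_lincomb_fst_iff by blast
  moreover have "l v* g_matrix R \<noteq> 0" if "?M *v l \<noteq> 0" for l
    \<comment> \<open>by skewness \<open>M l = - (l G) F\<close>\<close>
  proof
    assume "l v* g_matrix R = 0"
    then have "transpose ?M *v l = 0"
      by (simp add: vector_matrix_mul_assoc[symmetric])
    moreover have "(- ?M) *v l = - (?M *v l)"
      by (simp add: vec_eq_iff matrix_vector_mult_def sum_negf)
    ultimately show False
      using that by (simp add: composite_matrix_skew[OF assms(1)])
  qed
  with Z outside have "locally_surjective R"
    unfolding locally_surjective_def surj_lincomb_snd_iff by blast
  ultimately show ?thesis ..
qed

lemma f_matrix_nonzero_if_locally_injective:
  assumes "locally_injective R"
  shows "f_matrix R \<noteq> 0"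
proof -
  obtain Z where "zariski_closed Z" "codim_ge2 Z"
    and inj: "\<forall>l. l \<noteq> 0 \<and> ppt l \<notin> Z \<longrightarrow> f_matrix R *v l \<noteq> 0"
    using assms unfolding locally_injective_def inj_lincomb_fst_iff by blast
  then obtain l where "l \<noteq> 0" "ppt l \<notin> Z"
    using codim_ge2_point_outside by blast
  with inj show ?thesis
    by auto
qed

lemma g_matrix_nonzero_if_locally_surjective:
  assumes "locally_surjective R"
  shows "g_matrix R \<noteq> 0"
proof -
  obtain Z where "zariski_closed Z" "codim_ge2 Z"
    and surj: "\<forall>l. l \<noteq> 0 \<and> ppt l \<notin> Z \<longrightarrow> l v* g_matrix R \<noteq> 0"
    using assms unfolding locally_surjective_def surj_lincomb_snd_iff by blast
  then obtain l where "l \<noteq> 0" "ppt l \<notin> Z"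
    using codim_ge2_point_outside by blast
  with surj show ?thesis
    by auto
qed

lemma composite_nonzero_iff_locally_injective:
  assumes "is_rep R" and ker: "\<forall>v. g_matrix R *v v = 0 \<longrightarrow> v = 0"
  shows "g_matrix R ** f_matrix R \<noteq> 0 \<longleftrightarrow> locally_injective R"
proof
  assume "locally_injective R"
  then obtain j where "column j (f_matrix R) \<noteq> 0"
    using f_matrix_nonzero_if_locally_injective matrix_eq_0_iff_columns by blast
  with ker have "column j (g_matrix R ** f_matrix R) \<noteq> 0"
    unfolding column_matrix_mult by blast
  then show "g_matrix R ** f_matrix R \<noteq> 0"
    by (auto simp: matrix_eq_0_iff_columns)
qed (use assms locally_injective_and_surjective_if_composite_nonzero in blast)

lemma composite_nonzero_iff_locally_surjective:
  assumes "is_rep R" and ker: "\<forall>l. f_matrix R *v l = 0 \<longrightarrow> l = 0"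
  shows "g_matrix R ** f_matrix R \<noteq> 0 \<longleftrightarrow> locally_surjective R"
proof
  assume "locally_surjective R"
  then have "g_matrix R \<noteq> 0"
    by (rule g_matrix_nonzero_if_locally_surjective)
  show "g_matrix R ** f_matrix R \<noteq> 0"
  proof
    assume composite: "g_matrix R ** f_matrix R = 0"
    have "g_matrix R *v v = 0" for v
    proof -
      obtain l where "v = f_matrix R *v l"
        using ker trivial_kernel_iff_surj by (metis surjD)
      then show ?thesis
        by (simp add: matrix_vector_mul_assoc composite)
    qed
    then have "g_matrix R = 0"
      by (simp add: matrix_eq_0_iff_columns flip: matrix_vector_mult_axis)
    with \<open>g_matrix R \<noteq> 0\<close> show False ..
  qed
qed (use assms locally_injective_and_surjective_if_composite_nonzero in blast)

section \<open>Subrepresentations\<close>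

lemma is_subrep_top_zero_iff:
  "is_subrep R Wm W0 {0} \<longleftrightarrow> vec.subspace Wm \<and> vec.subspace W0 \<and>
     (\<forall>j x. x \<in> Wm \<longrightarrow> fst R j *v x \<in> W0) \<and> (\<forall>v\<in>W0. g_matrix R *v v = 0)"
  by (auto simp: is_subrep_def snd_mult_eq vec_eq_iff)

lemma is_subrep_kernel_of_g_matrix:
  assumes "vec.subspace Wm" "\<And>j x. x \<in> Wm \<Longrightarrow> g_matrix R *v (fst R j *v x) = 0"
  shows "is_subrep R Wm {v. g_matrix R *v v = 0} {0}"
  unfolding is_subrep_top_zero_iff
  using assms vec.subspace_kernel by auto

lemma subreps_with_zero_top_trivial_iff:
  "(\<forall>Wm W0. is_subrep R Wm W0 {0} \<longrightarrow> Wm = {0} \<and> W0 = {0}) \<longleftrightarrow>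
     (\<forall>v. g_matrix R *v v = 0 \<longrightarrow> v = 0) \<and> g_matrix R ** f_matrix R \<noteq> 0"
  (is "?trivial \<longleftrightarrow> ?ker \<and> ?composite")
proof
  assume trivial: ?trivial
  have "is_subrep R {0} {v. g_matrix R *v v = 0} {0}"
    by (rule is_subrep_kernel_of_g_matrix) simp_all
  with trivial have ?ker
    by blast
  moreover have ?composite
  proof
    assume "g_matrix R ** f_matrix R = 0"
    then have "g_matrix R *v column j (f_matrix R) = 0" for j
      by (simp add: column_matrix_mult[symmetric] matrix_eq_0_iff_columns)
    then have "is_subrep R UNIV {v. g_matrix R *v v = 0} {0}"
      by (intro is_subrep_kernel_of_g_matrix) (simp_all add: fst_mult_eq vector_scalar_commute)
    with trivial have "(1::complex^1) = 0"
      by blast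
    then show False
      by (simp add: vec_eq_iff)
  qed
  ultimately show "?ker \<and> ?composite" ..
next
  assume "?ker \<and> ?composite"
  then have ker: ?ker and composite: ?composite
    by blast+
  show ?trivial
  proof (intro allI impI conjI)
    fix Wm W0 assume sub: "is_subrep R Wm W0 {0}"
    then have "W0 \<subseteq> {0}" "0 \<in> W0"
      using ker vec.subspace_0 unfolding is_subrep_top_zero_iff by blast+
    then show W0: "W0 = {0}"
      by blast
    have "x = 0" if "x \<in> Wm" for x
    proof (rule ccontr)
      assume "x \<noteq> 0"
      then have "x $ 1 \<noteq> 0"
        by (simp add: vec_eq_iff)
      have "fst R j *v x \<in> W0" for j
        using sub that unfolding is_subrep_def by blast
      with W0 \<open>x $ 1 \<noteq> 0\<close> have "column j (f_matrix R) = 0" for j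
        by (simp add: fst_mult_eq)
      then have "f_matrix R = 0"
        by (simp add: matrix_eq_0_iff_columns)
      with composite show False
        by simp
    qed
    moreover have "0 \<in> Wm"
      using sub vec.subspace_0 unfolding is_subrep_def by blast
    ultimately show "Wm = {0}"
      by blast
  qed
qed

lemma subreps_with_full_source_full_iff:
  "(\<forall>W0 W1. is_subrep R UNIV W0 W1 \<longrightarrow> W0 = UNIV \<and> W1 = UNIV) \<longleftrightarrow>
     (\<forall>l. f_matrix R *v l = 0 \<longrightarrow> l = 0) \<and> g_matrix R ** f_matrix R \<noteq> 0"
  (is "?full \<longleftrightarrow> ?ker \<and> ?composite")
proof
  assume full: ?full
  have "is_subrep R UNIV (range ((*v) (f_matrix R))) UNIV"
    unfolding is_subrep_def
  proof (intro conjI allI impI)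
    show "vec.subspace (range ((*v) (f_matrix R)))"
      by (rule vec.subspace_image) simp
    show "fst R j *v x \<in> range ((*v) (f_matrix R))" for j x
    proof
      show "fst R j *v x = f_matrix R *v (x $ 1 *s axis j 1)"
        by (simp add: fst_mult_eq vector_scalar_commute matrix_vector_mult_axis)
    qed simp
  qed simp_all
  with full have ?ker
    using trivial_kernel_iff_surj by blast
  moreover have ?composite
  proof
    assume "g_matrix R ** f_matrix R = 0"
    then have "g_matrix R *v column j (f_matrix R) = 0" for j
      by (simp add: column_matrix_mult[symmetric] matrix_eq_0_iff_columns)
    then have "is_subrep R UNIV {v. g_matrix R *v v = 0} {0}"
      by (intro is_subrep_kernel_of_g_matrix) (simp_all add: fst_mult_eq vector_scalar_commute)
    with full have "(1::complex^1) = 0"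
      by blast
    then show False
      by (simp add: vec_eq_iff)
  qed
  ultimately show "?ker \<and> ?composite" ..
next
  assume "?ker \<and> ?composite"
  then have ker: ?ker and composite: ?composite
    by blast+
  show ?full
  proof (intro allI impI conjI)
    fix W0 W1 assume sub: "is_subrep R UNIV W0 W1"
    have "fst R j *v 1 \<in> W0" for j
      using sub unfolding is_subrep_def by blast
    then have "column j (f_matrix R) \<in> W0" for j
      by (simp add: fst_mult_eq)
    then have "f_matrix R *v l \<in> W0" for l
      using sub unfolding matrix_vector_mult_eq_sum_columns is_subrep_def
      by (intro vec.subspace_sum vec.subspace_scale) auto
    then show W0: "W0 = UNIV"
      using ker trivial_kernel_iff_surj by (metis surjD UNIV_eq_I)
    have "W1 \<noteq> {0}"
    proof
      assume "W1 = {0}"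
      with sub have "is_subrep R UNIV UNIV {0}"
        unfolding W0 by simp
      then have "g_matrix R *v v = 0" for v
        unfolding is_subrep_top_zero_iff by blast
      then have "g_matrix R = 0"
        by (simp add: matrix_eq_0_iff_columns flip: matrix_vector_mult_axis)
      with composite show False
        by simp
    qed
    then show "W1 = UNIV"
      using sub subspace_of_line_cases unfolding is_subrep_def by blast
  qed
qed

section \<open>King stability\<close>

lemma theta_dot_eq: "theta_dot (\<alpha>, \<beta>, \<gamma>) (a, b, c) = \<alpha> * a + \<beta> * b + \<gamma> * c"
  by (simp add: theta_dot_def)

text \<open>With \<open>\<gamma> = - \<alpha> - 4 \<beta>\<close> one has \<open>\<theta> \<cdot> (a, b, c) = \<alpha> (a - c) + \<beta> (b - 4 c)\<close>.\<close>
lemma theta_dot_of_beta_pos: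
  fixes \<alpha> \<beta> \<gamma> :: real and a b c :: nat
  assumes "\<alpha> > 0" "\<beta> > 0" "\<alpha> + 4 * \<beta> + \<gamma> = 0" "a \<le> 1" "b \<le> 4" "c \<le> 1"
  shows "theta_dot (\<alpha>, \<beta>, \<gamma>) (a, b, c) \<le> 0 \<longleftrightarrow> (c = 0 \<longrightarrow> a = 0 \<and> b = 0)"
    and "theta_dot (\<alpha>, \<beta>, \<gamma>) (a, b, c) = 0 \<longleftrightarrow> (a, b, c) = (0, 0, 0) \<or> (a, b, c) = (1, 4, 1)"
proof -
  have "a \<in> {0, 1}" "b \<in> {0, 1, 2, 3, 4}" "c \<in> {0, 1}"
    using assms(4-6) by auto
  with assms(1-3) show "theta_dot (\<alpha>, \<beta>, \<gamma>) (a, b, c) \<le> 0 \<longleftrightarrow> (c = 0 \<longrightarrow> a = 0 \<and> b = 0)"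
    and "theta_dot (\<alpha>, \<beta>, \<gamma>) (a, b, c) = 0 \<longleftrightarrow> (a, b, c) = (0, 0, 0) \<or> (a, b, c) = (1, 4, 1)"
    by (auto simp: theta_dot_eq)
qed

lemma theta_dot_of_beta_neg:
  fixes \<alpha> \<beta> \<gamma> :: real and a b c :: nat
  assumes "\<alpha> > 0" "\<beta> < 0" "\<gamma> < 0" "\<alpha> + 4 * \<beta> + \<gamma> = 0" "a \<le> 1" "b \<le> 4" "c \<le> 1"
  shows "theta_dot (\<alpha>, \<beta>, \<gamma>) (a, b, c) \<le> 0 \<longleftrightarrow> (a = 1 \<longrightarrow> b = 4 \<and> c = 1)"
    and "theta_dot (\<alpha>, \<beta>, \<gamma>) (a, b, c) = 0 \<longleftrightarrow> (a, b, c) = (0, 0, 0) \<or> (a, b, c) = (1, 4, 1)"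
proof -
  have "a \<in> {0, 1}" "b \<in> {0, 1, 2, 3, 4}" "c \<in> {0, 1}"
    using assms(5-7) by auto
  with assms(1-4) show "theta_dot (\<alpha>, \<beta>, \<gamma>) (a, b, c) \<le> 0 \<longleftrightarrow> (a = 1 \<longrightarrow> b = 4 \<and> c = 1)"
    and "theta_dot (\<alpha>, \<beta>, \<gamma>) (a, b, c) = 0 \<longleftrightarrow> (a, b, c) = (0, 0, 0) \<or> (a, b, c) = (1, 4, 1)"
    by (auto simp: theta_dot_eq)
qed

lemma sdim_bounds:
  "fst (sdim Wm W0 W1) \<le> 1 \<and> fst (snd (sdim Wm W0 W1)) \<le> 4 \<and> snd (snd (sdim Wm W0 W1)) \<le> 1"
  using dim_subset_UNIV_cart_gen[of Wm] dim_subset_UNIV_cart_gen[of W0]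
    dim_subset_UNIV_cart_gen[of W1]
  by (simp add: sdim_def)

lemma sdim_eq_zero_iff:
  "is_subrep R Wm W0 W1 \<Longrightarrow> sdim Wm W0 W1 = (0, 0, 0) \<longleftrightarrow> (Wm, W0, W1) = ({0}, {0}, {0})"
  unfolding is_subrep_def sdim_def by (simp add: subspace_dim_eq_0_iff del: vec.dim_eq_0)

lemma sdim_eq_full_iff:
  "is_subrep R Wm W0 W1 \<Longrightarrow> sdim Wm W0 W1 = (1, 4, 1) \<longleftrightarrow> (Wm, W0, W1) = (UNIV, UNIV, UNIV)"
  unfolding is_subrep_def sdim_def
  using subspace_dim_eq_card_iff[of Wm] subspace_dim_eq_card_iff[of W0]
    subspace_dim_eq_card_iff[of W1]
  by simp

lemma semistable_iff_stable_if_generic: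
  assumes "theta_dot \<theta> (1, 4, 1) = 0"
    and generic: "\<And>a b c. a \<le> 1 \<Longrightarrow> b \<le> 4 \<Longrightarrow> c \<le> 1 \<Longrightarrow> theta_dot \<theta> (a, b, c) = 0 \<Longrightarrow>
      (a, b, c) = (0, 0, 0) \<or> (a, b, c) = (1, 4, 1)"
  shows "semistable \<theta> R \<longleftrightarrow> stable \<theta> R"
proof
  assume semi: "semistable \<theta> R"
  show "stable \<theta> R"
    unfolding stable_def
  proof (intro conjI allI impI)
    fix Wm W0 W1
    assume S: "is_subrep R Wm W0 W1 \<and> (Wm, W0, W1) \<noteq> ({0}, {0}, {0}) \<and>
      (Wm, W0, W1) \<noteq> (UNIV, UNIV, UNIV)"
    then have "sdim Wm W0 W1 \<noteq> (0, 0, 0)" "sdim Wm W0 W1 \<noteq> (1, 4, 1)"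
      using sdim_eq_zero_iff sdim_eq_full_iff by blast+
    then have "theta_dot \<theta> (sdim Wm W0 W1) \<noteq> 0"
      using generic sdim_bounds[of Wm W0 W1] by (metis prod.collapse)
    moreover have "theta_dot \<theta> (sdim Wm W0 W1) \<le> 0"
      using semi S unfolding semistable_def by blast
    ultimately show "theta_dot \<theta> (sdim Wm W0 W1) < 0"
      by linarith
  qed (rule assms(1))
next
  assume st: "stable \<theta> R"
  show "semistable \<theta> R"
    unfolding semistable_def
  proof (intro conjI allI impI)
    fix Wm W0 W1
    assume S: "is_subrep R Wm W0 W1"
    show "theta_dot \<theta> (sdim Wm W0 W1) \<le> 0"
    proof (cases "(Wm, W0, W1) = ({0}, {0}, {0}) \<or> (Wm, W0, W1) = (UNIV, UNIV, UNIV)")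
      case True
      then have "sdim Wm W0 W1 = (0, 0, 0) \<or> sdim Wm W0 W1 = (1, 4, 1)"
        using sdim_eq_zero_iff[OF S] sdim_eq_full_iff[OF S] by blast
      then show ?thesis
        using assms(1) by (auto simp: theta_dot_def)
    next
      case False
      with st S show ?thesis
        unfolding stable_def by fastforce
    qed
  qed (rule assms(1))
qed

lemma semistable_iff_subreps_with_zero_top_trivial:
  fixes \<alpha> \<beta> \<gamma> :: real
  assumes "\<alpha> > 0" "\<beta> > 0" "\<alpha> + 4 * \<beta> + \<gamma> = 0"
  shows "semistable (\<alpha>, \<beta>, \<gamma>) R \<longleftrightarrow> (\<forall>Wm W0. is_subrep R Wm W0 {0} \<longrightarrow> Wm = {0} \<and> W0 = {0})"
proof -
  have "theta_dot (\<alpha>, \<beta>, \<gamma>) (sdim Wm W0 W1) \<le> 0 \<longleftrightarrow> (W1 = {0} \<longrightarrow> Wm = {0} \<and> W0 = {0})"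
    if "is_subrep R Wm W0 W1" for Wm W0 W1
    using that theta_dot_of_beta_pos(1)[OF assms] sdim_bounds[of Wm W0 W1]
    unfolding is_subrep_def sdim_def by (simp add: subspace_dim_eq_0_iff del: vec.dim_eq_0)
  moreover have "theta_dot (\<alpha>, \<beta>, \<gamma>) (1, 4, 1) = 0"
    using assms(3) by (simp add: theta_dot_eq)
  ultimately show ?thesis
    unfolding semistable_def by auto
qed

lemma semistable_iff_subreps_with_full_source_full:
  fixes \<alpha> \<beta> \<gamma> :: real
  assumes "\<alpha> > 0" "\<beta> < 0" "\<gamma> < 0" "\<alpha> + 4 * \<beta> + \<gamma> = 0"
  shows "semistable (\<alpha>, \<beta>, \<gamma>) R \<longleftrightarrow> (\<forall>W0 W1. is_subrep R UNIV W0 W1 \<longrightarrow> W0 = UNIV \<and> W1 = UNIV)"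
proof -
  have "theta_dot (\<alpha>, \<beta>, \<gamma>) (sdim Wm W0 W1) \<le> 0 \<longleftrightarrow> (Wm = UNIV \<longrightarrow> W0 = UNIV \<and> W1 = UNIV)"
    if "is_subrep R Wm W0 W1" for Wm W0 W1
    using that theta_dot_of_beta_neg(1)[OF assms] sdim_bounds[of Wm W0 W1]
      subspace_dim_eq_card_iff[of Wm] subspace_dim_eq_card_iff[of W0]
      subspace_dim_eq_card_iff[of W1]
    unfolding is_subrep_def sdim_def by simp
  moreover have "theta_dot (\<alpha>, \<beta>, \<gamma>) (1, 4, 1) = 0"
    using assms(4) by (simp add: theta_dot_eq)
  ultimately show ?thesis
    unfolding semistable_def by auto
qed

lemma king_stability_beta_pos:
  fixes \<alpha> \<beta> \<gamma> :: real
  assumes "\<alpha> > 0" "\<beta> > 0" "\<alpha> + 4 * \<beta> + \<gamma> = 0" "is_rep R"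
  shows "semistable (\<alpha>, \<beta>, \<gamma>) R \<longleftrightarrow> stable (\<alpha>, \<beta>, \<gamma>) R"
    and "semistable (\<alpha>, \<beta>, \<gamma>) R \<longleftrightarrow> globally_surjective R \<and> locally_injective R"
proof -
  show "semistable (\<alpha>, \<beta>, \<gamma>) R \<longleftrightarrow> stable (\<alpha>, \<beta>, \<gamma>) R"
    using assms(3) theta_dot_of_beta_pos(2)[OF assms(1-3)]
    by (intro semistable_iff_stable_if_generic) (simp_all add: theta_dot_eq)
  show "semistable (\<alpha>, \<beta>, \<gamma>) R \<longleftrightarrow> globally_surjective R \<and> locally_injective R"
    unfolding semistable_iff_subreps_with_zero_top_trivial[OF assms(1-3)]
      subreps_with_zero_top_trivial_iff globally_surjective_iff
    using composite_nonzero_iff_locally_injective[OF assms(4)] by blast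
qed

lemma king_stability_beta_neg:
  fixes \<alpha> \<beta> \<gamma> :: real
  assumes "\<alpha> > 0" "\<beta> < 0" "\<gamma> < 0" "\<alpha> + 4 * \<beta> + \<gamma> = 0" "is_rep R"
  shows "semistable (\<alpha>, \<beta>, \<gamma>) R \<longleftrightarrow> stable (\<alpha>, \<beta>, \<gamma>) R"
    and "semistable (\<alpha>, \<beta>, \<gamma>) R \<longleftrightarrow> globally_injective R \<and> locally_surjective R"
proof -
  show "semistable (\<alpha>, \<beta>, \<gamma>) R \<longleftrightarrow> stable (\<alpha>, \<beta>, \<gamma>) R"
    using assms(4) theta_dot_of_beta_neg(2)[OF assms(1-4)]
    by (intro semistable_iff_stable_if_generic) (simp_all add: theta_dot_eq)
  show "semistable (\<alpha>, \<beta>, \<gamma>) R \<longleftrightarrow> globally_injective R \<and> locally_surjective R"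
    unfolding semistable_iff_subreps_with_full_source_full[OF assms(1-4)]
      subreps_with_full_source_full_iff globally_injective_iff
    using composite_nonzero_iff_locally_surjective[OF assms(5)] by blast
qed

theorem mainTheorem13:
  fixes \<alpha> \<gamma> :: real
  assumes "\<alpha> > 0" and "\<gamma> < 0"
  defines "\<theta> \<equiv> (\<alpha>, - (\<alpha> + \<gamma>) / 4, \<gamma>)"
  shows "(\<gamma> < - \<alpha> \<longrightarrow> (\<forall>R. is_rep R \<longrightarrow>
            (semistable \<theta> R \<longleftrightarrow> stable \<theta> R) \<and>
            (semistable \<theta> R \<longleftrightarrow> globally_surjective R \<and> locally_injective R))) \<and>
         (\<gamma> > - \<alpha> \<longrightarrow> (\<forall>R. is_rep R \<longrightarrow>
            (semistable \<theta> R \<longleftrightarrow> stable \<theta> R) \<and>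
            (semistable \<theta> R \<longleftrightarrow> globally_injective R \<and> locally_surjective R)))"
proof -
  define \<beta> where "\<beta> = - (\<alpha> + \<gamma>) / 4"
  have \<theta>: "\<theta> = (\<alpha>, \<beta>, \<gamma>)" and sum: "\<alpha> + 4 * \<beta> + \<gamma> = 0"
    unfolding \<theta>_def \<beta>_def by (simp_all add: field_simps)
  have "\<beta> > 0" if "\<gamma> < - \<alpha>"
    using that unfolding \<beta>_def by simp
  moreover have "\<beta> < 0" if "\<gamma> > - \<alpha>"
    using that unfolding \<beta>_def by simp
  ultimately show ?thesis
    unfolding \<theta>
    using king_stability_beta_pos[OF assms(1) _ sum]
      king_stability_beta_neg[OF assms(1) _ assms(2) sum]
    by blast
qed

end
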